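(* Let $\mathcal I,\mathcal J$ be ideals on $\omega$. If $\mathcal I$ contains a tall summable ideal and Player I has a winning strategy in the game $G(\mathcal J,A,f)$ for all $A\notin\mathcal J$ and all $\mathcal J$-to-one functions $f:A\to\omega$ (in particular, if $\mathcal I$ contains a tall summable ideal and $\mathcal J$ is a Borel ideal such that for each $A\notin\mathcal J$ the ideal $\mathcal J\restriction A$ is not $\le_K$-above any tall summable ideal), then $$\operatorname{cov}(\mathcal M)\le\mathfrak{fip}(\mathcal I,\mathcal J,\omega^\omega).$$
   Context: An ideal on a set $X$ is a family of subsets of $X$ closed under finite unions and subsets, containing all finite subsets of $X$ and not containing $X$; $\mathcal J^+=\mathcal P(X)\setminus\mathcal J$. Borel refers to the topology of $\mathcal P(\omega)\cong\{0,1\}^\omega$. $\operatorname{cov}(\mathcal M)$ is the least number of meager sets covering the real line; $\mathfrak c=2^{\aleph_0}$. A summable ideal is $\mathcal I_g=\{A\subseteq\omega:\sum_{n\in A}g(n)<\infty\}$ with $g:\omega\to[0,\infty)$, $\sum_{n\in\omega}g(n)=\infty$; it is tall (every infinite subset of $\omega$ contains an infinite member) iff $g(n)\to0$. $\mathcal J\restriction A=\{B\cap A:B\in\mathcal J\}$ is an ideal on $A$ for $A\notin\mathcal J$; it is $\le_K$-above $\mathcal I_g$ if there is $f:A\to\omega$ with $f^{-1}[B]\in\mathcal J\restriction A$ for all $B\in\mathcal I_g$. A function $f:A\to\omega$ is $\mathcal J$-to-one if $f^{-1}[\{n\}]\in\mathcal J$ for every $n$. The game $G(\mathcal J,A,f)$: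 first Player I plays $k_0\in\omega$; then, for $n=0,1,2,\dots$, Player II plays a finite set $G_n\subseteq\omega$ and Player I responds with $(F_n,k_{n+1})$, where $F_n\subseteq\omega$ is finite, $F_n\cap G_n=\emptyset$, $|F_n|\le k_n$, and $k_{n+1}\in\omega$. Player I wins iff $f^{-1}[\bigcup_nF_n]\notin\mathcal J\restriction A$; otherwise Player II wins. A nonempty family $\mathcal A\subseteq\mathcal P(\omega)$ has $\mathcal J^+$-FIP if $\bigcap F\in\mathcal J^+$ for each finite $F\subseteq\mathcal A$. $\mathfrak{fip}(\mathcal I,\mathcal J,\mathcal F)$ (for $\mathcal F\subseteq\omega^\omega$) is the minimum of the set consisting of $\mathfrak c^+$ and all cardinals $|\mathcal A|$ such that $\mathcal A\subseteq\mathcal P(\omega)$ has $\mathcal J^+$-FIP and it is not true that for every $f\in\mathcal F$ there is $B\in\mathcal I$ such that $\mathcal A\cup\{f^{-1}[B]\}$ has $\mathcal J^+$-FIP. *)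

theory Defs
  imports "HOL-Analysis.Analysis"
begin

unbundle cardinal_syntax

definition ideal_on :: "'a set \<Rightarrow> 'a set set \<Rightarrow> bool" where
  "ideal_on X J \<longleftrightarrow> J \<subseteq> Pow X \<and> (\<forall>A B. A \<in> J \<and> B \<subseteq> A \<longrightarrow> B \<in> J) \<and>
     (\<forall>A B. A \<in> J \<and> B \<in> J \<longrightarrow> A \<union> B \<in> J) \<and>
     (\<forall>A. finite A \<and> A \<subseteq> X \<longrightarrow> A \<in> J) \<and> X \<notin> J"

definition positive_sets :: "nat set set \<Rightarrow> nat set set" where
  "positive_sets J = - J"

definition restrict_ideal :: "'a set set \<Rightarrow> 'a set \<Rightarrow> 'a set set" where
  "restrict_ideal J A = {B \<inter> A | B. B \<in> J}"

definition summable_ideal :: "(nat \<Rightarrow> real) \<Rightarrow> nat set set" where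
  "summable_ideal g = {A. g summable_on A}"

definition is_summable_ideal :: "nat set set \<Rightarrow> bool" where
  "is_summable_ideal S \<longleftrightarrow>
     (\<exists>g. (\<forall>n. 0 \<le> g n) \<and> \<not> g summable_on UNIV \<and> S = summable_ideal g)"

definition tall :: "nat set set \<Rightarrow> bool" where
  "tall S \<longleftrightarrow> (\<forall>X. infinite X \<longrightarrow> (\<exists>Y \<in> S. Y \<subseteq> X \<and> infinite Y))"

definition tall_summable_ideal :: "nat set set \<Rightarrow> bool" where
  "tall_summable_ideal S \<longleftrightarrow> is_summable_ideal S \<and> tall S"

(* Here and below a function from A to omega is a total function of which only the values
   on A are used; the preimage of B under it is "f -` B \<inter> A". *)

definition katetov_above :: "nat set \<Rightarrow> nat set set \<Rightarrow> nat set set \<Rightarrow> bool" where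
  "katetov_above A K S \<longleftrightarrow> (\<exists>f::nat \<Rightarrow> nat. \<forall>B \<in> S. f -` B \<inter> A \<in> K)"

definition borel_family :: "nat set set \<Rightarrow> bool" where
  "borel_family J \<longleftrightarrow>
     (\<lambda>X n. n \<in> X) ` J \<in> sets (borel :: (nat \<Rightarrow> bool) measure)"

definition ideal_to_one :: "nat set set \<Rightarrow> nat set \<Rightarrow> (nat \<Rightarrow> nat) \<Rightarrow> bool" where
  "ideal_to_one J A f \<longleftrightarrow> (\<forall>n. f -` {n} \<inter> A \<in> J)"

(* A run of the game is given by k (k 0 is Player I's opening move), the moves G of Player II,
   and F, where (F n, k (Suc n)) is the response of Player I to G n. *)

definition legal_I ::
    "(nat \<Rightarrow> nat) \<Rightarrow> (nat \<Rightarrow> nat set) \<Rightarrow> (nat \<Rightarrow> nat set) \<Rightarrow> bool" where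
  "legal_I k G F \<longleftrightarrow> (\<forall>n. finite (F n) \<and> F n \<inter> G n = {} \<and> card (F n) \<le> k n)"

definition legal_II :: "(nat \<Rightarrow> nat set) \<Rightarrow> bool" where
  "legal_II G \<longleftrightarrow> (\<forall>n. finite (G n))"

definition payoff_I ::
    "nat set set \<Rightarrow> nat set \<Rightarrow> (nat \<Rightarrow> nat) \<Rightarrow> (nat \<Rightarrow> nat set) \<Rightarrow> bool" where
  "payoff_I J A f F \<longleftrightarrow> f -` (\<Union>n. F n) \<inter> A \<notin> restrict_ideal J A"

(* A strategy for Player I: the opening move k0, and a map \<sigma> sending the nonempty list
   [G 0, ..., G n] of the moves Player II has made so far to the response (F n, k (Suc n)). *)

definition strat_F :: "(nat set list \<Rightarrow> nat set \<times> nat) \<Rightarrow> (nat \<Rightarrow> nat set) \<Rightarrow> nat \<Rightarrow> nat set" where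
  "strat_F \<sigma> G n = fst (\<sigma> (map G [0..<Suc n]))"

primrec strat_k ::
    "nat \<Rightarrow> (nat set list \<Rightarrow> nat set \<times> nat) \<Rightarrow> (nat \<Rightarrow> nat set) \<Rightarrow> nat \<Rightarrow> nat" where
  "strat_k k0 \<sigma> G 0 = k0"
| "strat_k k0 \<sigma> G (Suc n) = snd (\<sigma> (map G [0..<Suc n]))"

definition I_has_winning_strategy :: "nat set set \<Rightarrow> nat set \<Rightarrow> (nat \<Rightarrow> nat) \<Rightarrow> bool" where
  "I_has_winning_strategy J A f \<longleftrightarrow>
     (\<exists>k0 \<sigma>. \<forall>G. legal_II G \<longrightarrow>
        legal_I (strat_k k0 \<sigma> G) G (strat_F \<sigma> G) \<and> payoff_I J A f (strat_F \<sigma> G))"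

(* The least element of a set of cardinals, as a representative determined up to =o. *)

definition min_card :: "'a rel set \<Rightarrow> 'a rel" where
  "min_card R = (SOME r. r \<in> R \<and> (\<forall>r' \<in> R. r \<le>o r'))"

lemma min_card:
  assumes "R \<noteq> {}" "\<forall>r \<in> R. Card_order r"
  shows "min_card R \<in> R" and "\<And>r. r \<in> R \<Longrightarrow> min_card R \<le>o r"
proof -
  have "\<exists>r. r \<in> R \<and> (\<forall>r' \<in> R. r \<le>o r')"
    using exists_minim_Card_order[OF assms] by blast
  from someI_ex[OF this]
  show "min_card R \<in> R" and "\<And>r. r \<in> R \<Longrightarrow> min_card R \<le>o r"
    unfolding min_card_def by blast+
qed

definition nowhere_dense :: "'a::topological_space set \<Rightarrow> bool" where
  "nowhere_dense S \<longleftrightarrow> interior (closure S) = {}"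

definition meager :: "'a::topological_space set \<Rightarrow> bool" where
  "meager S \<longleftrightarrow> (\<exists>N :: nat \<Rightarrow> 'a set. (\<forall>n. nowhere_dense (N n)) \<and> S = (\<Union>n. N n))"

definition cov_M :: "real set rel" where
  "cov_M = min_card {|\<M>| | \<M> :: real set set. (\<forall>M \<in> \<M>. meager M) \<and> \<Union>\<M> = UNIV}"

(* For F = {} the intersection is UNIV, which belongs to "positive_sets J" when J is an ideal. *)

definition has_FIP :: "nat set set \<Rightarrow> nat set set \<Rightarrow> bool" where
  "has_FIP J \<A> \<longleftrightarrow> \<A> \<noteq> {} \<and> (\<forall>F. finite F \<and> F \<subseteq> \<A> \<longrightarrow> \<Inter>F \<in> positive_sets J)"

(* The successor cardinal of the continuum lives on the type "nat set set"; the image under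
   \<lambda>X. {X} is an equipotent copy of \<A> on that type. *)

definition fip :: "nat set set \<Rightarrow> nat set set \<Rightarrow> (nat \<Rightarrow> nat) set \<Rightarrow> nat set set rel" where
  "fip I J \<F> = min_card
     (insert (cardSuc |UNIV :: nat set set| )
       {|(\<lambda>X. {X}) ` \<A>| | \<A>. has_FIP J \<A> \<and>
          \<not> (\<forall>f \<in> \<F>. \<exists>B \<in> I. has_FIP J (\<A> \<union> {f -` B}))})"

end

theory Submission
  imports Defs
begin

text \<open>
  Fix a function \<open>g\<close> tending to zero, with divergent sum, whose summable ideal is contained in \<open>I\<close>. Every
  real \<open>x\<close> is decoded into a sequence of finite sets of natural numbers whose \<open>i\<close>-th term has
  \<open>g\<close>-mass at most \<open>1 / 2 ^ i\<close>. The union \<open>generic_set g x\<close> of these blocks belongs to \<open>I\<close> for every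
  \<open>x\<close>, and it behaves like a Cohen-generic element of the summable ideal.

  Suppose that a family \<open>\<A>\<close> with the finite intersection property cannot be extended by the
  preimage of a member of \<open>I\<close>. Then for every \<open>x\<close> some finite intersection \<open>A\<close> of members of \<open>\<A>\<close> satisfies
  \<open>f -` generic_set g x \<inter> A \<in> J\<close>. If each \<open>A\<close> is responsible for only a meager set of reals, then the line
  is covered by as many meager sets as \<open>\<A>\<close> has finite subsets. By the Baire category theorem, \<open>\<A>\<close> is then
  infinite, and so the number of these sets is at most the cardinality of \<open>\<A>\<close>
  (\<open>meager_cover_of_maximal_FIP_family\<close>, \<open>cov_M_le_index_set\<close>).

  The heart of the matter is therefore that \<open>f -` generic_set g x \<inter> A \<in> J\<close> holds for only meagerly
  many \<open>x\<close> when \<open>A \<notin> J\<close> and \<open>f\<close> is \<open>J\<close>-to-one on \<open>A\<close>; an easier argument applies when infinitely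
  many fibres are outside \<open>J\<close>, and the remaining \<open>A\<close> can be avoided. Given a winning strategy of Player I, a generic set
  contains all answers of Player I in some run of the game, because there are only countably many
  positions and Player II can force the answer at each of them to be an admissible block
  (\<open>generic_preimage_meager_if_winning_strategy\<close>).

  For Borel \<open>J\<close> the same conclusion is obtained without any determinacy of the game. The sets \<open>X\<close> with
  \<open>f -` X \<inter> A \<in> J\<close> form a Borel ideal \<open>K\<close>. Membership in \<open>K\<close> is insensitive to finite changes, so
  by a zero-one law \<open>generic_set g x \<in> K\<close> holds either for meagerly or for comeagerly many \<open>x\<close>. In
  the second case \<open>K\<close> contains the summable ideal of \<open>sqrt g\<close>
  (\<open>sqrt_summable_ideal_subset\<close>), which is again tall. This makes the restriction of \<open>J\<close> to
  \<open>A\<close> Katetov-above a tall summable ideal.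
\<close>

section \<open>Meager sets of reals\<close>

text \<open>On the line, intervals suffice to test nowhere density. Taking the gap closed and strictly inside
  lets gaps be nested, so that a point can be steered past countably many nowhere dense sets.\<close>

lemma nowhere_dense_iff_intervals:
  fixes S :: "real set"
  shows "nowhere_dense S \<longleftrightarrow>
    (\<forall>a b. a < b \<longrightarrow> (\<exists>c d. a < c \<and> c < d \<and> d < b \<and> {c..d} \<inter> S = {}))"
proof
  assume S: "nowhere_dense S"
  show "\<forall>a b. a < b \<longrightarrow> (\<exists>c d. a < c \<and> c < d \<and> d < b \<and> {c..d} \<inter> S = {})"
  proof (intro allI impI)
    fix a b :: real assume "a < b"
    have "\<not> {a<..<b} \<subseteq> closure S"
    proof
      assume "{a<..<b} \<subseteq> closure S"
      then have "{a<..<b} \<subseteq> interior (closure S)" by (simp add: interior_maximal)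
      then show False using S \<open>a < b\<close> by (auto simp: nowhere_dense_def)
    qed
    then obtain x where x: "x \<in> {a<..<b} - closure S" by blast
    have "open ({a<..<b} - closure S)" by (simp add: open_Diff)
    then obtain e where "e > 0" and e: "cball x e \<subseteq> {a<..<b} - closure S"
      using x open_contains_cball by blast
    have "{x - e..x + e} \<subseteq> {a<..<b} - closure S" using e by (simp add: cball_eq_atLeastAtMost)
    moreover have "x - e \<in> {x - e..x + e}" "x + e \<in> {x - e..x + e}" using \<open>e > 0\<close> by auto
    ultimately show "\<exists>c d. a < c \<and> c < d \<and> d < b \<and> {c..d} \<inter> S = {}"
      using \<open>e > 0\<close> closure_subset[of S]
      by (intro exI[of _ "x - e"] exI[of _ "x + e"]) fastforce
  qed
next
  assume gap: "\<forall>a b. a < b \<longrightarrow> (\<exists>c d. a < c \<and> c < d \<and> d < b \<and> {c..d} \<inter> S = {})"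
  show "nowhere_dense S"
  proof (rule ccontr)
    assume "\<not> nowhere_dense S"
    then obtain y where "y \<in> interior (closure S)" by (auto simp: nowhere_dense_def)
    then obtain e where "e > 0" and e: "ball y e \<subseteq> closure S"
      using mem_interior by blast
    obtain c d where cd: "y - e < c" "c < d" "d < y + e" "{c..d} \<inter> S = {}"
      using gap[rule_format, of "y - e" "y + e"] \<open>e > 0\<close> by auto
    have "(c + d) / 2 \<in> ball y e"
      using cd by (simp add: ball_eq_greaterThanLessThan)
    then have "(c + d) / 2 \<in> closure S" using e by blast
    moreover have "open {c<..<d}" "(c + d) / 2 \<in> {c<..<d}" using cd by auto
    ultimately have "{c<..<d} \<inter> S \<noteq> {}" using open_Int_closure_eq_empty by blast
    then show False using cd(4) by (auto simp: disjoint_iff)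
  qed
qed

lemma nowhere_dense_subset: "nowhere_dense T \<Longrightarrow> S \<subseteq> T \<Longrightarrow> nowhere_dense S"
  unfolding nowhere_dense_def by (metis closure_mono interior_mono subset_empty)

lemma meager_subset: "meager T \<Longrightarrow> S \<subseteq> T \<Longrightarrow> meager S"
proof -
  assume "meager T" "S \<subseteq> T"
  then obtain N :: "nat \<Rightarrow> 'a set" where "\<And>n. nowhere_dense (N n)" "T = (\<Union>n. N n)"
    unfolding meager_def by blast
  then show ?thesis
    unfolding meager_def using \<open>S \<subseteq> T\<close>
    by (intro exI[of _ "\<lambda>n. N n \<inter> S"]) (auto intro: nowhere_dense_subset)
qed

lemma nowhere_dense_imp_meager: "nowhere_dense S \<Longrightarrow> meager S"
  unfolding meager_def by (intro exI[of _ "\<lambda>_. S"]) auto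

lemma meager_UN_nat:
  assumes "\<And>n::nat. meager (M n)"
  shows "meager (\<Union>n. M n)"
proof -
  obtain N where N: "\<And>n k. nowhere_dense (N n k)" "\<And>n. M n = (\<Union>k::nat. N n k)"
  proof -
    have "\<forall>n. \<exists>N. (\<forall>k::nat. nowhere_dense (N k)) \<and> M n = (\<Union>k. N k)"
      using assms unfolding meager_def by blast
    from choice[OF this] show ?thesis using that by blast
  qed
  let ?N = "\<lambda>i. N (fst (prod_decode i)) (snd (prod_decode i))"
  have "N n k = ?N (prod_encode (n, k))" for n k by simp
  then have "(\<Union>n. \<Union>k. N n k) = (\<Union>i. ?N i)" by blast
  then show ?thesis
    unfolding meager_def N(2) using N(1) by (intro exI[of _ ?N]) simp
qed

lemma meager_empty: "meager {}"
  by (intro nowhere_dense_imp_meager) (simp add: nowhere_dense_def)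

lemma meager_UN_countable:
  assumes "countable I" "\<And>i. i \<in> I \<Longrightarrow> meager (M i)"
  shows "meager (\<Union>i\<in>I. M i)"
proof (cases "I = {}")
  case False
  then have "(\<Union>i\<in>I. M i) = (\<Union>n. M (from_nat_into I n))"
    using range_from_nat_into[OF False assms(1)] by (metis image_image)
  then show ?thesis
    using meager_UN_nat[of "\<lambda>n. M (from_nat_into I n)"] assms(2) from_nat_into[OF False] by simp
qed (simp add: meager_empty)

lemma meager_Un: "meager S \<Longrightarrow> meager T \<Longrightarrow> meager (S \<union> T)"
  using meager_UN_countable[of "{S, T}" "\<lambda>x. x"] by auto

lemma meager_translation:
  fixes S :: "real set"
  assumes "meager S"
  shows "meager {x. x + q \<in> S}"
proof -
  obtain N :: "nat \<Rightarrow> real set" where N: "\<And>n. nowhere_dense (N n)" "S = (\<Union>n. N n)"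
    using assms unfolding meager_def by blast
  have "nowhere_dense {x. x + q \<in> N n}" for n
    unfolding nowhere_dense_iff_intervals
  proof (intro allI impI)
    fix a b :: real assume "a < b"
    then obtain c d where cd: "a + q < c" "c < d" "d < b + q" "{c..d} \<inter> N n = {}"
      using N(1)[of n] unfolding nowhere_dense_iff_intervals by (meson add_strict_right_mono)
    then have "{c - q..d - q} \<inter> {x. x + q \<in> N n} = {}"
      by (force simp: disjoint_iff algebra_simps)
    then show "\<exists>c d. a < c \<and> c < d \<and> d < b \<and> {c..d} \<inter> {x. x + q \<in> N n} = {}"
      using cd by (intro exI[of _ "c - q"] exI[of _ "d - q"]) auto
  qed
  then show ?thesis
    unfolding meager_def N(2) by (intro exI[of _ "\<lambda>n. {x. x + q \<in> N n}"]) auto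
qed

lemma not_meager_UNIV: "\<not> meager (UNIV :: real set)"
proof
  assume "meager (UNIV :: real set)"
  then obtain N :: "nat \<Rightarrow> real set" where N: "\<And>n. nowhere_dense (N n)" "UNIV = (\<Union>n. N n)"
    unfolding meager_def by blast
  have "UNIV \<subseteq> closure (\<Inter> (range (\<lambda>n. - closure (N n))))"
  proof (rule Baire)
    fix T assume "T \<in> range (\<lambda>n. - closure (N n))"
    then obtain n where T: "T = - closure (N n)" by auto
    then have "closure T = UNIV"
      using N(1)[of n] by (simp add: nowhere_dense_def closure_complement)
    then show "openin (top_of_set UNIV) T \<and> UNIV \<subseteq> closure T" using T by (simp add: open_Compl)
  qed auto
  moreover have "(\<Inter> (range (\<lambda>n. - closure (N n)))) = {}"
  proof -
    have "x \<in> (\<Union>n. closure (N n))" for x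
      using N(2) closure_subset by (metis UNIV_I UN_iff subsetD)
    then show ?thesis by auto
  qed
  ultimately show False by simp
qed

section \<open>The Baire property of Borel sets\<close>

lemma nowhere_dense_frontier_of_closed:
  assumes "closed C"
  shows "nowhere_dense (C - interior C)"
proof -
  have "closed (C - interior C)" using assms by (simp add: closed_Diff)
  moreover have "interior (C - interior C) = {}"
    using interior_mono[OF Diff_subset, of C "interior C"] interior_subset[of "C - interior C"] by blast
  ultimately show ?thesis by (simp add: nowhere_dense_def)
qed

text \<open>The sets that agree with an open set up to a meager set form a \<open>\<sigma>\<close>-algebra. For complements,
  the open set passes to the interior of its complement, at the cost of a nowhere dense boundary.\<close>

lemma borel_imp_Baire_property:
  fixes S :: "'a::topological_space set"
  assumes "S \<in> sets borel"
  shows "\<exists>U. open U \<and> meager ((S - U) \<union> (U - S))"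
proof -
  have "S \<in> sigma_sets UNIV {S. open S}" using assms by (simp add: borel_def)
  then show ?thesis
  proof induction
    case (Basic S)
    then show ?case by (intro exI[of _ S]) (simp add: meager_empty)
  next
    case Empty
    show ?case by (intro exI[of _ "{}"]) (simp add: meager_empty)
  next
    case (Compl S)
    then obtain U where U: "open U" "meager ((S - U) \<union> (U - S))" by blast
    have "meager (((S - U) \<union> (U - S)) \<union> (- U - interior (- U)))"
      using U nowhere_dense_frontier_of_closed[of "- U"]
      by (metis closed_Compl meager_Un nowhere_dense_imp_meager)
    moreover have "(UNIV - S - interior (- U)) \<union> (interior (- U) - (UNIV - S)) \<subseteq>
        ((S - U) \<union> (U - S)) \<union> (- U - interior (- U))"
      using interior_subset[of "- U"] by blast
    ultimately have "meager ((UNIV - S - interior (- U)) \<union> (interior (- U) - (UNIV - S)))"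
      by (rule meager_subset)
    then show ?case by (intro exI[of _ "interior (- U)"] conjI open_interior)
  next
    case (Union A)
    then obtain U where U: "\<And>i. open (U i)" "\<And>i. meager ((A i - U i) \<union> (U i - A i))"
      by metis
    have "meager (\<Union>i::nat. (A i - U i) \<union> (U i - A i))" using U by (intro meager_UN_nat)
    then have "meager ((\<Union> (range A) - \<Union> (range U)) \<union> (\<Union> (range U) - \<Union> (range A)))"
      by (rule meager_subset) auto
    then show ?case using U(1) by (intro exI[of _ "\<Union> (range U)"]) auto
  qed
qed

text \<open>Dyadic translations carry any nonempty open set over the whole line, so a Borel set
  invariant under them is comeager as soon as it is comeager in one interval.\<close>

lemma dyadic_invariant_zero_one:
  fixes E :: "real set"
  assumes "E \<in> sets borel"
    and inv: "\<And>x (k::int) (m::nat). x + k / 2 ^ m \<in> E \<longleftrightarrow> x \<in> E"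
    and "\<not> meager E"
  shows "meager (- E)"
proof -
  obtain U where U: "open U" "meager ((E - U) \<union> (U - E))"
    using borel_imp_Baire_property[OF assms(1)] by blast
  have "U \<noteq> {}" using U(2) \<open>\<not> meager E\<close> by auto
  then obtain y e where "e > 0" and e: "ball y e \<subseteq> U" using U(1) openE by blast
  let ?q = "\<lambda>(k::int, m::nat). k / 2 ^ m :: real"
  have "meager (\<Union>p. {x. x + ?q p \<in> U - E})"
    using meager_subset[OF U(2), of "U - E"]
    by (intro meager_UN_countable meager_translation) auto
  moreover have "- E \<subseteq> (\<Union>p. {x. x + ?q p \<in> U - E})"
  proof
    fix x assume "x \<in> - E"
    obtain m where m: "inverse (2 ^ m) < e"
      using real_arch_pow_inv[of e "1/2"] \<open>e > 0\<close> by (auto simp: power_one_over inverse_eq_divide)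
    let ?k = "\<lfloor>(y - x) * 2 ^ m\<rfloor>"
    have "of_int ?k \<le> (y - x) * 2 ^ m" "(y - x) * 2 ^ m < of_int ?k + 1" by linarith+
    then have "of_int ?k / 2 ^ m \<le> y - x" "y - x < of_int ?k / 2 ^ m + inverse (2 ^ m)"
      by (auto simp: field_simps)
    then have "x + ?k / 2 ^ m \<in> ball y e" using m by (auto simp: dist_real_def)
    then have "x + ?q (?k, m) \<in> U - E" using e \<open>x \<in> - E\<close> inv by auto
    then show "x \<in> (\<Union>p. {x. x + ?q p \<in> U - E})" by blast
  qed
  ultimately show ?thesis by (rule meager_subset)
qed

section \<open>Digits of reals and generic sets\<close>

text \<open>The fractional part of \<open>2 ^ i * x\<close> runs through the unit interval infinitely often near every
  point as \<open>i\<close> grows, and the reciprocal turns it into an unbounded integer. The digits thus turn a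
  real into a sequence of natural numbers. Every value is taken on a nondegenerate interval, as in
  Baire space, and translation by a dyadic rational affects only finitely many digits.\<close>

definition digit :: "nat \<Rightarrow> real \<Rightarrow> nat" where
  "digit i x = nat (\<lfloor>1 / frac (2 ^ i * x)\<rfloor> - 1)"

text \<open>Once \<open>2 ^ i\<close> exceeds \<open>2 / (b - a)\<close>, the interval contains a full period \<open>[z, z + 1] / 2 ^ i\<close>, inside
  which the value \<open>c\<close> is taken where the fractional part lies between \<open>1 / (c + 2)\<close> and \<open>1 / (c + 1)\<close>.
  The bound on \<open>i\<close> depends on the interval but not on \<open>c\<close>.\<close>

lemma digit_attains_all_values:
  fixes a b :: real
  assumes "a < b"
  shows "\<exists>N. \<forall>i\<ge>N. \<forall>c. \<exists>a' b'. a \<le> a' \<and> a' < b' \<and> b' \<le> b \<and>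
    (\<forall>x. a' < x \<and> x < b' \<longrightarrow> digit i x = c)"
proof -
  obtain N :: nat where N: "2 / (b - a) < 2 ^ N" using real_arch_pow by fastforce
  have "\<exists>a' b'. a \<le> a' \<and> a' < b' \<and> b' \<le> b \<and> (\<forall>x. a' < x \<and> x < b' \<longrightarrow> digit i x = c)"
    if "i \<ge> N" for i c
  proof -
    have "2 ^ N \<le> (2 ^ i :: real)" using that by simp
    with N have "2 / (b - a) < 2 ^ i" by linarith
    then have period: "2 < 2 ^ i * b - 2 ^ i * a" using assms by (simp add: field_simps)
    define z where "z = \<lceil>2 ^ i * a\<rceil>"
    have z: "2 ^ i * a \<le> z" "z + 1 < 2 ^ i * b" unfolding z_def using period by linarith+
    let ?a = "(z + 1 / (real c + 2)) / 2 ^ i" and ?b = "(z + 1 / (real c + 1)) / 2 ^ i"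
    have "1 / (real c + 2) < 1 / (real c + 1)" "0 < 1 / (real c + 2)" "1 / (real c + 1) \<le> 1"
      by (auto simp: field_simps)
    note c = this
    have "a \<le> ?a" using add_mono[OF z(1) less_imp_le[OF c(2)]]
      by (simp add: pos_le_divide_eq mult.commute)
    moreover have "?a < ?b" using c by (intro divide_strict_right_mono) auto
    moreover have "z + 1 / (real c + 1) \<le> 2 ^ i * b" using z(2) c(3) by linarith
    then have "?b \<le> b" by (simp add: pos_divide_le_eq mult.commute)
    moreover have "digit i x = c" if "?a < x" "x < ?b" for x
    proof -
      define t where "t = 2 ^ i * x - z"
      have t: "1 / (real c + 2) < t" "t < 1 / (real c + 1)"
        using that unfolding t_def
        by (simp_all only: pos_divide_less_eq pos_less_divide_eq zero_less_power zero_less_numeral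
            less_diff_eq diff_less_eq add.commute mult.commute)
      have "frac (2 ^ i * x) = t"
      proof (rule frac_unique_iff[THEN iffD2], intro conjI)
        show "0 \<le> t" "t < 1" using t c by linarith+
      qed (simp add: t_def)
      moreover have "\<lfloor>1 / t\<rfloor> = int c + 1"
        using t c by (intro floor_unique) (auto simp: field_simps)
      ultimately show ?thesis by (simp add: digit_def)
    qed
    ultimately show ?thesis by blast
  qed
  then show ?thesis by blast
qed

text \<open>This is how category enters: a generic real agrees with any prescribed sequence at some place.\<close>

lemma nowhere_dense_avoiding_digits:
  "nowhere_dense {x. \<forall>i. digit i x \<noteq> c i}"
  unfolding nowhere_dense_iff_intervals
proof (intro allI impI)
  fix a b :: real assume "a < b"
  then obtain i a' b' where *: "a \<le> a'" "a' < b'" "b' \<le> b"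
    "\<And>x. a' < x \<and> x < b' \<Longrightarrow> digit i x = c i"
    using digit_attains_all_values[OF \<open>a < b\<close>] by blast
  then have "digit i x = c i" if "x \<in> {(2 * a' + b') / 3..(a' + 2 * b') / 3}" for x
    using that by (intro *(4)) auto
  then have "{(2 * a' + b') / 3..(a' + 2 * b') / 3} \<inter> {x. \<forall>i. digit i x \<noteq> c i} = {}" by blast
  then show "\<exists>u v. a < u \<and> u < v \<and> v < b \<and> {u..v} \<inter> {x. \<forall>i. digit i x \<noteq> c i} = {}"
    using * by (intro exI[of _ "(2 * a' + b') / 3"] exI[of _ "(a' + 2 * b') / 3"]) auto
qed

lemma digit_dyadic_translation:
  fixes k :: int
  assumes "m \<le> i"
  shows "digit i (x + k / 2 ^ m) = digit i x"
proof -
  have "2 ^ i * (x + k / 2 ^ m) = 2 ^ i * x + of_int (2 ^ (i - m) * k)"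
    using power_diff[OF _ assms, of "2 :: real"] by (simp add: distrib_left)
  moreover have "frac (2 ^ i * x + of_int (2 ^ (i - m) * k)) = frac (2 ^ i * x)"
    unfolding frac_def floor_add_int[symmetric] by simp
  ultimately show ?thesis by (simp add: digit_def)
qed

lemma measurable_digit [measurable]: "digit i \<in> measurable borel (count_space UNIV)"
  unfolding digit_def frac_def by measurable

text \<open>Digits code finite sets. Oversized sets are discarded so that every union of blocks
  has finite \<open>g\<close>-mass, whatever the real is.\<close>

definition block :: "(nat \<Rightarrow> real) \<Rightarrow> nat \<Rightarrow> real \<Rightarrow> nat set" where
  "block g i x =
    (let F = set_decode (digit i x) in if sum g F \<le> 1 / 2 ^ i then F else {})"

definition generic_set :: "(nat \<Rightarrow> real) \<Rightarrow> real \<Rightarrow> nat set" where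
  "generic_set g x = (\<Union>i. block g i x)"

lemma block_eqI:
  assumes "digit i x = set_encode F" "finite F" "sum g F \<le> 1 / 2 ^ i"
  shows "block g i x = F"
  using assms by (simp add: block_def)

lemma generic_set_in_summable_ideal:
  assumes "\<And>n. 0 \<le> g n"
  shows "generic_set g x \<in> summable_ideal g"
proof -
  have block: "finite (block g i x)" "sum g (block g i x) \<le> (1 / 2) ^ i" for i
    by (auto simp: block_def Let_def power_one_over)
  have "sum g F \<le> 2" if "finite F" "F \<subseteq> generic_set g x" for F
  proof -
    have "\<exists>i. n \<in> block g i x" if "n \<in> F" for n
      using that \<open>F \<subseteq> _\<close> by (auto simp: generic_set_def)
    then obtain \<iota> where \<iota>: "\<And>n. n \<in> F \<Longrightarrow> n \<in> block g (\<iota> n) x" by metis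
    obtain M where M: "\<And>n. n \<in> F \<Longrightarrow> \<iota> n < M"
      using \<open>finite F\<close> finite_nat_set_iff_bounded[of "\<iota> ` F"] by auto
    have "sum g F \<le> sum g (\<Union>i\<in>{..<M}. block g i x)"
      using \<iota> M assms block by (intro sum_mono2) auto
    also have "\<dots> \<le> (\<Sum>i<M. sum g (block g i x))"
    proof (induction M)
      case (Suc M)
      have "sum g (\<Union>i<Suc M. block g i x) \<le> sum g (\<Union>i<M. block g i x) + sum g (block g M x)"
        using block assms by (auto simp: lessThan_Suc Un_commute sum_Un sum_nonneg)
      with Suc show ?case by simp
    qed simp
    also have "\<dots> \<le> (\<Sum>i<M. (1 / 2) ^ i)" using block by (intro sum_mono) auto
    also have "\<dots> \<le> (\<Sum>i. (1 / 2 :: real) ^ i)" by (intro sum_le_suminf) auto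
    also have "\<dots> = 2" by (simp add: suminf_geometric)
    finally show ?thesis .
  qed
  then show ?thesis
    unfolding summable_ideal_def mem_Collect_eq
    by (intro nonneg_bdd_above_summable_on assms bdd_aboveI[of _ 2]) auto
qed

lemma generic_set_dyadic_translation:
  fixes k :: int
  shows "generic_set g (x + k / 2 ^ m) \<subseteq> generic_set g x \<union> (\<Union>i<m. block g i (x + k / 2 ^ m))"
proof -
  have "block g i (x + k / 2 ^ m) = block g i x" if "\<not> i < m" for i
    using that by (simp add: block_def digit_dyadic_translation)
  then show ?thesis unfolding generic_set_def by blast
qed

instance bool :: second_countable_topology
proof
  show "\<exists>B::bool set set. countable B \<and> open = generate_topology B"
    by (intro exI[of _ UNIV])
      (auto simp: fun_eq_iff open_discrete intro: generate_topology.Basis)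
qed

text \<open>Each coordinate of the characteristic function of the generic set is a countable Boolean
  combination of conditions on digits.\<close>

lemma borel_generic_set_preimage:
  assumes "borel_family K"
  shows "{x. generic_set g x \<in> K} \<in> sets borel"
proof -
  have "(\<lambda>x n. n \<in> generic_set g x) \<in> borel_measurable borel"
  proof (rule measurable_coordinatewise_then_product)
    fix n
    let ?ok = "\<lambda>i c. n \<in> (if sum g (set_decode c) \<le> 1 / 2 ^ i then set_decode c else {})"
    have "n \<in> generic_set g x \<longleftrightarrow> (\<exists>i. ?ok i (digit i x))" for x
      by (auto simp: generic_set_def block_def Let_def)
    moreover have "Measurable.pred borel (\<lambda>x. \<exists>i. ?ok i (digit i x))" by measurable
    ultimately show "(\<lambda>x. n \<in> generic_set g x) \<in> borel_measurable borel"
      by (auto intro: measurable_compose[where N = "count_space UNIV"])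
  qed
  then have "(\<lambda>x n. n \<in> generic_set g x) -` ((\<lambda>X n. n \<in> X) ` K) \<inter> space borel \<in> sets borel"
    using assms unfolding borel_family_def by (rule measurable_sets)
  moreover have "(\<lambda>x n. n \<in> generic_set g x) -` ((\<lambda>X n. n \<in> X) ` K) = {x. generic_set g x \<in> K}"
    by (auto simp: fun_eq_iff) (metis set_eqI)
  ultimately show ?thesis by simp
qed

section \<open>Ideals that contain comeagerly many generic sets\<close>

lemma ideal_on_subset: "ideal_on X J \<Longrightarrow> A \<in> J \<Longrightarrow> B \<subseteq> A \<Longrightarrow> B \<in> J"
  unfolding ideal_on_def by blast

lemma ideal_on_Un: "ideal_on X J \<Longrightarrow> A \<in> J \<Longrightarrow> B \<in> J \<Longrightarrow> A \<union> B \<in> J"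
  unfolding ideal_on_def by blast

lemma ideal_on_finite: "ideal_on UNIV J \<Longrightarrow> finite A \<Longrightarrow> A \<in> J"
  unfolding ideal_on_def by simp

text \<open>A dyadic translation changes only finitely many blocks, hence only finitely many elements.\<close>

lemma generic_set_in_ideal_dyadic_invariant:
  fixes k :: int
  assumes "ideal_on UNIV K"
  shows "generic_set g (x + k / 2 ^ m) \<in> K \<longleftrightarrow> generic_set g x \<in> K"
proof -
  have transfer: "generic_set g (y + l / 2 ^ m) \<in> K" if "generic_set g y \<in> K" for y and l :: int
  proof (rule ideal_on_subset[OF assms _ generic_set_dyadic_translation])
    have "finite (\<Union>i<m. block g i (y + l / 2 ^ m))" by (auto simp: block_def Let_def)
    then show "generic_set g y \<union> (\<Union>i<m. block g i (y + l / 2 ^ m)) \<in> K"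
      using assms that by (blast intro: ideal_on_Un ideal_on_finite)
  qed
  have "x = (x + k / 2 ^ m) + of_int (- k) / 2 ^ m" by simp
  with transfer[of x k] transfer[of "x + k / 2 ^ m" "- k"] show ?thesis by metis
qed

lemma summable_on_small_tail:
  fixes h :: "'a \<Rightarrow> real"
  assumes "h summable_on X" "\<And>x. x \<in> X \<Longrightarrow> 0 \<le> h x" "0 < e"
  shows "\<exists>F0. finite F0 \<and> F0 \<subseteq> X \<and> (\<forall>F. finite F \<and> F \<subseteq> X - F0 \<longrightarrow> sum h F \<le> e)"
proof -
  have "(sum h \<longlongrightarrow> infsum h X) (finite_subsets_at_top X)"
    using has_sum_infsum[OF assms(1)] by (simp add: has_sum_def)
  then have "\<forall>\<^sub>F F in finite_subsets_at_top X. infsum h X - e < sum h F"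
    using assms(3) by (intro order_tendstoD) auto
  then obtain F0 where F0: "finite F0" "F0 \<subseteq> X" "infsum h X - e < sum h F0"
    unfolding eventually_finite_subsets_at_top by blast
  have "sum h F \<le> e" if "finite F" "F \<subseteq> X - F0" for F
  proof -
    have "sum h F0 + sum h F = sum h (F0 \<union> F)"
      using that F0 by (intro sum.union_disjoint[symmetric]) auto
    also have "\<dots> \<le> infsum h X"
      using that F0 assms by (intro finite_sum_le_infsum) auto
    finally show ?thesis using F0 by linarith
  qed
  with F0 show ?thesis by blast
qed

text \<open>Let \<open>X\<close> have finite \<open>sqrt g\<close>-mass. The aim is to cover \<open>X\<close>, up to finitely many elements, by three
  sets \<open>generic_set g x\<close> with \<open>x\<close> outside all the nowhere dense sets \<open>N t\<close> whose union is the
  exceptional set. Such an \<open>x\<close> is the limit of nested rational intervals. Each interval avoids the next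
  \<open>N t\<close> and has one digit, at a place \<open>i\<close>, coding the next piece of \<open>X\<close>. The only obstacle is
  the size bound \<open>1 / 2 ^ i\<close> on blocks. If the piece lies where \<open>g \<le> (1 / 4) ^ i\<close>, then
  \<open>g \<le> (1 / 2) ^ i * sqrt g\<close> there, so a piece of \<open>sqrt g\<close>-mass at most \<open>1\<close> is small enough.

  The place must be known before the piece begins. It is therefore chosen for all rational
  intervals with small code at once, independently of \<open>X\<close>: cut points \<open>\<nu> j\<close> grow so fast that
  \<open>g \<le> (1 / 4) ^ i\<close> holds beyond \<open>\<nu> (j + 1)\<close> for the place \<open>i\<close> serving the intervals with code below
  \<open>\<nu> j\<close>, and that
  the interval obtained after coding a subset of \<open>{\<nu> (j + 1)..<\<nu> (j + 2)}\<close> has code below \<open>\<nu> (j + 3)\<close>.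
  One step of the construction thus uses up three cut points and codes one of the three pieces
  between them, which is why the pieces are sorted by residue modulo \<open>3\<close>.\<close>

lemma sqrt_summable_ideal_subset:
  fixes g :: "nat \<Rightarrow> real"
  assumes g0: "\<And>n. 0 \<le> g n" and lim: "g \<longlonglongrightarrow> 0" and K: "ideal_on UNIV K"
    and comeager: "meager {x. generic_set g x \<notin> K}"
  shows "summable_ideal (\<lambda>n. sqrt (g n)) \<subseteq> K"
proof -
  obtain N where N: "\<And>i. nowhere_dense (N i)" "{x. generic_set g x \<notin> K} = (\<Union>i::nat. N i)"
    using comeager unfolding meager_def by blast
  \<comment> \<open>Natural numbers code rational intervals, so that finitely many of them lie below each bound.\<close>
  define lo hi :: "nat \<Rightarrow> real" where
    "lo k = of_rat (fst (from_nat k :: rat \<times> rat))" and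
    "hi k = of_rat (snd (from_nat k :: rat \<times> rat))" for k
  have "\<exists>M. \<forall>i\<ge>M. \<forall>c t. \<exists>k'. lo k \<le> lo k' \<and> lo k' < hi k' \<and> hi k' \<le> hi k \<and>
      (\<forall>x\<in>{lo k'..hi k'}. digit i x = c \<and> x \<notin> N t)" if "lo k < hi k" for k
  proof -
    obtain M where M: "\<And>i c. i \<ge> M \<Longrightarrow> \<exists>a b. lo k \<le> a \<and> a < b \<and> b \<le> hi k \<and>
        (\<forall>x. a < x \<and> x < b \<longrightarrow> digit i x = c)"
      using digit_attains_all_values[OF \<open>lo k < hi k\<close>] by blast
    show ?thesis
    proof (rule exI[of _ M], intro allI impI)
      fix i c t assume "M \<le> i"
      then obtain a b where ab: "lo k \<le> a" "a < b" "b \<le> hi k"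
        "\<And>x. a < x \<and> x < b \<Longrightarrow> digit i x = c" using M by meson
      obtain u v where uv: "a < u" "u < v" "v < b" "{u..v} \<inter> N t = {}"
        using N(1)[of t] \<open>a < b\<close> unfolding nowhere_dense_iff_intervals by meson
      obtain q where q: "u < of_rat q" "of_rat q < v" using of_rat_dense[OF uv(2)] by blast
      obtain p where p: "u < of_rat p" "of_rat p < (of_rat q :: real)"
        using of_rat_dense[OF q(1)] by blast
      have "lo (to_nat (p, q)) = of_rat p" "hi (to_nat (p, q)) = of_rat q"
        by (simp_all add: lo_def hi_def)
      moreover have "digit i x = c \<and> x \<notin> N t" if "x \<in> {of_rat p..of_rat q}" for x
        using that p q uv ab(4)[of x] by (auto simp: disjoint_iff)
      ultimately show "\<exists>k'. lo k \<le> lo k' \<and> lo k' < hi k' \<and> hi k' \<le> hi k \<and>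
          (\<forall>x\<in>{lo k'..hi k'}. digit i x = c \<and> x \<notin> N t)"
        using ab uv p q by (intro exI[of _ "to_nat (p, q)"]) auto
    qed
  qed
  then have "\<forall>k. \<exists>M. \<forall>i c t. lo k < hi k \<and> M \<le> i \<longrightarrow> (\<exists>k'. lo k \<le> lo k' \<and> lo k' < hi k' \<and> hi k' \<le> hi k \<and>
      (\<forall>x\<in>{lo k'..hi k'}. digit i x = c \<and> x \<notin> N t))" by meson
  from choice[OF this] obtain M where "\<forall>k i c t. lo k < hi k \<and> M k \<le> i \<longrightarrow> (\<exists>k'. lo k \<le> lo k' \<and> lo k' < hi k' \<and>
      hi k' \<le> hi k \<and> (\<forall>x\<in>{lo k'..hi k'}. digit i x = c \<and> x \<notin> N t))" by (elim exE)
  then obtain ch where ch: "\<And>k i c t. lo k < hi k \<Longrightarrow> M k \<le> i \<Longrightarrow>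
      lo k \<le> lo (ch k i c t) \<and> lo (ch k i c t) < hi (ch k i c t) \<and> hi (ch k i c t) \<le> hi k \<and>
      (\<forall>x\<in>{lo (ch k i c t)..hi (ch k i c t)}. digit i x = c \<and> x \<notin> N t)" by metis

  \<comment> \<open>A place at which all intervals with code below \<open>n\<close> can receive any digit.\<close>
  define pos where "pos n = (\<Sum>k<n. M k)" for n
  have pos: "M k \<le> pos n" if "k < n" for k n
    unfolding pos_def using that by (intro member_le_sum) auto
  have "\<exists>n'>n. (\<forall>x\<ge>n'. g x \<le> (1 / 4) ^ pos n) \<and>
      (\<forall>k<n. \<forall>l\<le>n. \<forall>t\<le>n. \<forall>F\<in>Pow {..<n}. ch k (pos l) (set_encode F) t < n')" for n
  proof -
    obtain n1 where n1: "\<And>x. x \<ge> n1 \<Longrightarrow> g x < (1 / 4) ^ pos n"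
      using order_tendstoD(2)[OF lim, of "(1 / 4) ^ pos n"] by (auto simp: eventually_sequentially)
    let ?C = "(\<lambda>(k, l, t, F). ch k (pos l) (set_encode F) t) ` ({..<n} \<times> {..n} \<times> {..n} \<times> Pow {..<n})"
    have "finite ?C" by simp
    from finite_nat_set_iff_bounded[THEN iffD1, OF this]
    obtain n2 where n2: "\<forall>y\<in>?C. y < n2" by (elim exE)
    have "ch k (pos l) (set_encode F) t < n2" if "k < n" "l \<le> n" "t \<le> n" "F \<in> Pow {..<n}" for k l t F
      using that by (intro n2[rule_format] image_eqI[where x = "(k, l, t, F)"]) auto
    then have "\<forall>k<n. \<forall>l\<le>n. \<forall>t\<le>n. \<forall>F\<in>Pow {..<n}.
        ch k (pos l) (set_encode F) t < Suc (n + n1 + n2)"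
      by (meson less_SucI trans_less_add2)
    moreover have "\<forall>x\<ge>Suc (n + n1 + n2). g x \<le> (1 / 4) ^ pos n"
      using n1 by (auto intro!: less_imp_le)
    ultimately show ?thesis by (intro exI[of _ "Suc (n + n1 + n2)"] conjI) auto
  qed
  then have "\<forall>n. \<exists>n'>n. (\<forall>x\<ge>n'. g x \<le> (1 / 4) ^ pos n) \<and>
      (\<forall>k<n. \<forall>l\<le>n. \<forall>t\<le>n. \<forall>F\<in>Pow {..<n}. ch k (pos l) (set_encode F) t < n')"
    by (intro allI)
  from choice[OF this] obtain \<Phi> where \<Phi>_all: "\<forall>n. n < \<Phi> n \<and> (\<forall>x\<ge>\<Phi> n. g x \<le> (1 / 4) ^ pos n) \<and>
      (\<forall>k<n. \<forall>l\<le>n. \<forall>t\<le>n. \<forall>F\<in>Pow {..<n}. ch k (pos l) (set_encode F) t < \<Phi> n)"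
    by (elim exE)
  have \<Phi>: "n < \<Phi> n" "\<Phi> n \<le> x \<Longrightarrow> g x \<le> (1 / 4) ^ pos n"
    "k < n \<Longrightarrow> l \<le> n \<Longrightarrow> t \<le> n \<Longrightarrow> F \<subseteq> {..<n} \<Longrightarrow> ch k (pos l) (set_encode F) t < \<Phi> n"
    for n x k l t F
    using \<Phi>_all by auto
  define k0 :: nat where "k0 = to_nat (0::rat, 1::rat)"
  define \<nu> where "\<nu> j = (\<Phi> ^^ j) (Suc k0)" for j
  have \<nu>_Suc: "\<nu> (Suc j) = \<Phi> (\<nu> j)" for j by (simp add: \<nu>_def)
  have "strict_mono \<nu>" by (simp add: strict_mono_Suc_iff \<nu>_Suc \<Phi>(1))
  then have \<nu>_mono: "i \<le> j \<Longrightarrow> \<nu> i \<le> \<nu> j" and \<nu>_ge: "j \<le> \<nu> j" for i j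
    by (auto simp: strict_mono_less_eq strict_mono_imp_increasing)

  \<comment> \<open>The pieces of one residue class modulo 3 lie together in a single generic set.\<close>
  have one_residue_class: "(\<Union>t. X \<inter> {\<nu> (3 * t + r + 1)..<\<nu> (3 * t + r + 2)}) \<in> K"
    if X: "\<And>F. finite F \<Longrightarrow> F \<subseteq> X \<Longrightarrow> (\<Sum>n\<in>F. sqrt (g n)) \<le> 1" for X r
  proof -
    define F where "F t = X \<inter> {\<nu> (3 * t + r + 1)..<\<nu> (3 * t + r + 2)}" for t
    define i where "i t = pos (\<nu> (3 * t + r))" for t
    define \<kappa> where "\<kappa> = rec_nat k0 (\<lambda>t k. ch k (i t) (set_encode (F t)) t)"
    have \<kappa>_Suc: "\<kappa> (Suc t) = ch (\<kappa> t) (i t) (set_encode (F t)) t" for t by (simp add: \<kappa>_def)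
    have \<kappa>: "lo (\<kappa> t) < hi (\<kappa> t) \<and> \<kappa> t < \<nu> (3 * t + r)" for t
    proof (induction t)
      case 0
      have "k0 < \<nu> 0" by (simp add: \<nu>_def)
      then have "k0 < \<nu> r" using \<nu>_mono[of 0 r] by simp
      then show ?case by (simp add: \<kappa>_def lo_def hi_def k0_def)
    next
      case (Suc t)
      have "M (\<kappa> t) \<le> i t" using Suc pos by (simp add: i_def)
      then have "lo (\<kappa> (Suc t)) < hi (\<kappa> (Suc t))" using ch Suc unfolding \<kappa>_Suc by blast
      moreover have "\<kappa> (Suc t) < \<Phi> (\<nu> (3 * t + r + 2))"
        unfolding \<kappa>_Suc i_def
      proof (rule \<Phi>(3))
        show "\<kappa> t < \<nu> (3 * t + r + 2)" using Suc \<nu>_mono[of "3 * t + r" "3 * t + r + 2"] by simp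
        show "\<nu> (3 * t + r) \<le> \<nu> (3 * t + r + 2)" by (rule \<nu>_mono) simp
        show "t \<le> \<nu> (3 * t + r + 2)" using \<nu>_ge[of "3 * t + r + 2"] by simp
      qed (auto simp: F_def)
      moreover have "\<Phi> (\<nu> (3 * t + r + 2)) = \<nu> (3 * Suc t + r)"
        by (simp add: \<nu>_Suc[symmetric] eval_nat_numeral)
      ultimately show ?case by simp
    qed
    have nested: "lo (\<kappa> t) \<le> lo (\<kappa> (Suc t)) \<and> hi (\<kappa> (Suc t)) \<le> hi (\<kappa> t) \<and>
        (\<forall>x\<in>{lo (\<kappa> (Suc t))..hi (\<kappa> (Suc t))}. digit (i t) x = set_encode (F t) \<and> x \<notin> N t)" for t
      unfolding \<kappa>_Suc using ch[of "\<kappa> t" "i t"] \<kappa>[of t] pos[of "\<kappa> t" "\<nu> (3 * t + r)"]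
      by (simp add: i_def)
    have "\<Inter> (range (\<lambda>t. {lo (\<kappa> t)..hi (\<kappa> t)})) \<noteq> {}"
    proof (rule compact_nest)
      show "compact {lo (\<kappa> t)..hi (\<kappa> t)}" "{lo (\<kappa> t)..hi (\<kappa> t)} \<noteq> {}" for t
        using \<kappa>[of t] by simp_all
      have "decseq (\<lambda>t. {lo (\<kappa> t)..hi (\<kappa> t)})"
        using nested by (intro decseq_SucI) simp
      then show "{lo (\<kappa> t)..hi (\<kappa> t)} \<subseteq> {lo (\<kappa> s)..hi (\<kappa> s)}" if "s \<le> t" for s t
        using that by (rule decseqD)
    qed
    then obtain x where x: "\<And>t. x \<in> {lo (\<kappa> t)..hi (\<kappa> t)}" by blast
    have "F t \<subseteq> generic_set g x" for t
    proof -
      have "sum g (F t) \<le> (\<Sum>n\<in>F t. (1 / 2) ^ i t * sqrt (g n))"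
      proof (rule sum_mono)
        fix n assume "n \<in> F t"
        then have "g n \<le> (1 / 4) ^ i t"
          using \<Phi>(2)[of "\<nu> (3 * t + r)" n] by (simp add: F_def i_def \<nu>_Suc)
        moreover have "sqrt ((1 / 4) ^ i t) = (1 / 2) ^ i t" by (simp add: real_sqrt_power real_sqrt_divide)
        ultimately have "sqrt (g n) \<le> (1 / 2) ^ i t" using real_sqrt_le_mono by metis
        then have "sqrt (g n) * sqrt (g n) \<le> (1 / 2) ^ i t * sqrt (g n)"
          by (rule mult_right_mono) (simp add: g0)
        then show "g n \<le> (1 / 2) ^ i t * sqrt (g n)" by (simp add: g0)
      qed
      also have "\<dots> \<le> (1 / 2) ^ i t * 1"
        unfolding sum_distrib_left[symmetric] by (intro mult_left_mono X) (auto simp: F_def)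
      finally have "block g (i t) x = F t"
        using nested[of t] x[of "Suc t"] by (intro block_eqI) (auto simp: F_def power_one_over)
      then show ?thesis unfolding generic_set_def by blast
    qed
    then have "(\<Union>t. F t) \<subseteq> generic_set g x" by (rule UN_least)
    moreover have "x \<notin> (\<Union>t. N t)" using nested x by auto
    then have "generic_set g x \<in> K" unfolding N(2)[symmetric] by simp
    ultimately show ?thesis
      unfolding F_def[symmetric] using ideal_on_subset[OF K] by metis
  qed

  show ?thesis
  proof
    fix X assume "X \<in> summable_ideal (\<lambda>n. sqrt (g n))"
    then obtain F0 where F0: "finite F0"
      "\<And>F. finite F \<Longrightarrow> F \<subseteq> X - F0 \<Longrightarrow> (\<Sum>n\<in>F. sqrt (g n)) \<le> 1"
      using summable_on_small_tail[of "\<lambda>n. sqrt (g n)" X 1] g0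
      by (auto simp: summable_ideal_def)
    define U where "U r = (\<Union>t. (X - F0) \<inter> {\<nu> (3 * t + r + 1)..<\<nu> (3 * t + r + 2)})" for r
    have U: "U r \<in> K" for r unfolding U_def by (intro one_residue_class F0(2))
    have "X \<subseteq> (F0 \<union> {..<\<nu> 1}) \<union> (U 0 \<union> U 1 \<union> U 2)"
    proof
      fix y assume "y \<in> X"
      show "y \<in> (F0 \<union> {..<\<nu> 1}) \<union> (U 0 \<union> U 1 \<union> U 2)"
      proof (cases "y \<in> F0 \<or> y < \<nu> 1")
        case False
        let ?j = "LEAST j. y < \<nu> j"
        have "y < \<nu> (Suc y)" using \<nu>_ge[of "Suc y"] by simp
        then have j: "y < \<nu> ?j" by (rule LeastI)
        have "1 < ?j" using j False \<nu>_mono[of ?j 1] by (meson le_trans not_less)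
        define s where "s = ?j - 2"
        have "?j = s + 2" using \<open>1 < ?j\<close> by (simp add: s_def)
        then have s: "\<nu> (s + 1) \<le> y" "y < \<nu> (s + 2)"
          using j not_less_Least[of "s + 1" "\<lambda>j. y < \<nu> j"] by auto
        have "s = 3 * (s div 3) + s mod 3" by simp
        then have "y \<in> U (s mod 3)"
          unfolding U_def using s False \<open>y \<in> X\<close> by (intro UN_I[of "s div 3"]) auto
        moreover have "s mod 3 = 0 \<or> s mod 3 = 1 \<or> s mod 3 = 2" by linarith
        ultimately show ?thesis by auto
      qed auto
    qed
    moreover have "F0 \<union> {..<\<nu> 1} \<in> K" using F0(1) by (intro ideal_on_finite[OF K]) simp
    then have "(F0 \<union> {..<\<nu> 1}) \<union> (U 0 \<union> U 1 \<union> U 2) \<in> K"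
      using ideal_on_Un[OF K] U by metis
    ultimately show "X \<in> K" by (rule ideal_on_subset[OF K, rotated])
  qed
qed

section \<open>Tall summable ideals\<close>

lemma tall_imp_tendsto_zero:
  assumes g0: "\<And>n. 0 \<le> g n" and "tall (summable_ideal g)"
  shows "g \<longlonglongrightarrow> 0"
proof (rule order_tendstoI)
  fix a :: real assume "a < 0"
  then show "\<forall>\<^sub>F n in sequentially. a < g n" using g0 by (auto intro: less_le_trans always_eventually)
next
  fix e :: real assume "0 < e"
  have "finite {n. e \<le> g n}"
  proof (rule ccontr)
    assume "infinite {n. e \<le> g n}"
    then obtain Y where Y: "g summable_on Y" "Y \<subseteq> {n. e \<le> g n}" "infinite Y"
      using assms(2) unfolding tall_def summable_ideal_def by blast
    obtain F0 where F0: "finite F0" "\<And>F. finite F \<Longrightarrow> F \<subseteq> Y - F0 \<Longrightarrow> sum g F \<le> e / 2"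
      using summable_on_small_tail[OF Y(1), of "e / 2"] g0 \<open>0 < e\<close> by auto
    have "Y - F0 \<noteq> {}" using Y(3) F0(1) by (metis finite.emptyI finite_Diff2)
    then obtain y where "y \<in> Y - F0" by blast
    with F0(2)[of "{y}"] Y(2) \<open>0 < e\<close> show False by auto
  qed
  then have "\<forall>\<^sub>F n in cofinite. \<not> e \<le> g n" by (simp add: eventually_cofinite)
  then show "\<forall>\<^sub>F n in sequentially. g n < e" by (simp add: cofinite_eq_sequentially not_le)
qed

text \<open>A sequence of distinct points of \<open>X\<close> along which \<open>g\<close> decays geometrically has finite mass.\<close>

lemma tendsto_zero_imp_tall:
  assumes g0: "\<And>n. 0 \<le> g n" and lim: "g \<longlonglongrightarrow> 0"
  shows "tall (summable_ideal g)"
  unfolding tall_def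
proof (intro allI impI)
  fix X :: "nat set" assume "infinite X"
  have pick: "\<exists>y. y \<in> X \<and> g y \<le> (1 / 2) ^ n \<and> m < y" for m n
  proof -
    obtain M where M: "\<And>y. y \<ge> M \<Longrightarrow> g y < (1 / 2) ^ n"
      using order_tendstoD(2)[OF lim, of "(1 / 2) ^ n"] by (auto simp: eventually_sequentially)
    obtain y where "y > M + m" "y \<in> X" using \<open>infinite X\<close> by (meson infinite_nat_iff_unbounded)
    then show ?thesis using M[of y] by (intro exI[of _ y]) auto
  qed
  obtain s where s: "\<And>n. s n \<in> X \<and> g (s n) \<le> (1 / 2) ^ n" "\<And>n. s n < s (Suc n)"
    using dependent_nat_choice[of "\<lambda>n y. y \<in> X \<and> g y \<le> (1 / 2) ^ n" "\<lambda>n y z. y < z"] pick by metis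
  have "inj s" using s(2) by (simp add: strict_mono_Suc_iff strict_mono_imp_inj_on)
  have "summable (\<lambda>n. (1 / 2 :: real) ^ n)" by simp
  then have "summable (g \<circ> s)"
    by (rule summable_comparison_test[rotated]) (use s(1) g0 in auto)
  then have "(g \<circ> s) summable_on UNIV" using g0 by (simp add: summable_on_UNIV_nonneg_real_iff)
  then have "range s \<in> summable_ideal g"
    unfolding summable_ideal_def mem_Collect_eq summable_on_reindex[OF \<open>inj s\<close>] .
  moreover have "infinite (range s)" using \<open>inj s\<close> by (simp add: range_inj_infinite)
  ultimately show "\<exists>Y\<in>summable_ideal g. Y \<subseteq> X \<and> infinite Y" using s(1) by blast
qed

text \<open>The square root preserves convergence to zero, and it dominates \<open>g\<close> wherever \<open>g \<le> 1\<close>.\<close>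

lemma tall_summable_ideal_sqrt:
  assumes g0: "\<And>n. 0 \<le> g n" and "\<not> g summable_on UNIV" and lim: "g \<longlonglongrightarrow> 0"
  shows "tall_summable_ideal (summable_ideal (\<lambda>n. sqrt (g n)))"
proof -
  have "\<not> summable (\<lambda>n. sqrt (g n))"
  proof
    assume "summable (\<lambda>n. sqrt (g n))"
    moreover have "\<forall>\<^sub>F n in sequentially. norm (g n) \<le> sqrt (g n)"
      using order_tendstoD(2)[OF lim, of 1]
    proof (rule eventually_mono)
      fix n assume "g n < 1"
      then have "sqrt (g n) * sqrt (g n) \<le> 1 * sqrt (g n)" by (intro mult_right_mono) (auto simp: g0)
      then show "norm (g n) \<le> sqrt (g n)" by (simp add: g0)
    qed simp
    ultimately have "summable g" by (rule summable_comparison_test_ev[rotated])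
    with assms show False by (simp add: summable_on_UNIV_nonneg_real_iff)
  qed
  then have "\<not> (\<lambda>n. sqrt (g n)) summable_on UNIV"
    by (simp add: summable_on_UNIV_nonneg_real_iff g0)
  moreover have "(\<lambda>n. sqrt (g n)) \<longlonglongrightarrow> 0" using tendsto_real_sqrt[OF lim] by simp
  ultimately show ?thesis
    unfolding tall_summable_ideal_def is_summable_ideal_def
    by (auto simp: g0 intro!: tendsto_zero_imp_tall exI[of _ "\<lambda>n. sqrt (g n)"])
qed

text \<open>The reals whose generic set is in \<open>K\<close> form a Borel set invariant under dyadic translations, so if
  they are not meager they are comeager. Then \<open>K\<close> contains the tall summable ideal of \<open>sqrt g\<close>.\<close>

lemma generic_set_meager_if_borel:
  assumes g0: "\<And>n. 0 \<le> g n" and "\<not> g summable_on UNIV" and lim: "g \<longlonglongrightarrow> 0"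
    and K: "ideal_on UNIV K" "borel_family K"
    and no_tall: "\<And>S. tall_summable_ideal S \<Longrightarrow> \<not> S \<subseteq> K"
  shows "meager {x. generic_set g x \<in> K}"
proof (rule ccontr)
  assume "\<not> meager {x. generic_set g x \<in> K}"
  then have "meager (- {x. generic_set g x \<in> K})"
    using generic_set_in_ideal_dyadic_invariant[OF K(1)]
    by (intro dyadic_invariant_zero_one borel_generic_set_preimage K(2)) auto
  then have "summable_ideal (\<lambda>n. sqrt (g n)) \<subseteq> K"
    by (intro sqrt_summable_ideal_subset g0 lim K(1)) (simp add: Compl_eq)
  with no_tall tall_summable_ideal_sqrt[OF assms(1-3)] show False by blast
qed

section \<open>Preimages of generic sets\<close>

text \<open>Being \<open>J\<close>-to-one is what puts finite sets into the pullback, so that membership of generic sets in it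
  is insensitive to finite changes.\<close>

lemma ideal_on_pullback:
  assumes J: "ideal_on UNIV J" and A: "A \<notin> J" and f: "ideal_to_one J A f"
  shows "ideal_on UNIV {X. f -` X \<inter> A \<in> J}"
proof -
  have "f -` X \<inter> A \<in> J" if "finite X" for X
    using that
  proof (induction X)
    case empty
    then show ?case using ideal_on_finite[OF J] by simp
  next
    case (insert n X)
    have "f -` insert n X \<inter> A = (f -` {n} \<inter> A) \<union> (f -` X \<inter> A)" by auto
    then show ?case using insert f ideal_on_Un[OF J] by (simp add: ideal_to_one_def)
  qed
  moreover have "f -` X \<inter> A \<in> J" if "f -` Y \<inter> A \<in> J" "X \<subseteq> Y" for X Y
    using that by (elim ideal_on_subset[OF J]) auto
  moreover have "f -` (X \<union> Y) \<inter> A \<in> J" if "f -` X \<inter> A \<in> J" "f -` Y \<inter> A \<in> J" for X Y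
    using ideal_on_Un[OF J that] by (simp add: Int_Un_distrib2)
  ultimately show ?thesis using A unfolding ideal_on_def by auto
qed

lemma borel_family_pullback:
  assumes "borel_family J"
  shows "borel_family {X. f -` X \<inter> A \<in> J}"
proof -
  let ?\<chi> = "\<lambda>X n. (n::nat) \<in> X"
  let ?T = "\<lambda>(y :: nat \<Rightarrow> bool) n. y (f n) \<and> n \<in> A"
  have "?T \<in> borel_measurable borel"
  proof (intro borel_measurable_continuous_onI continuous_on_coordinatewise_then_product)
    fix n
    have "continuous_on UNIV (\<lambda>y :: nat \<Rightarrow> bool. y (f n))" by simp
    then show "continuous_on UNIV (\<lambda>y :: nat \<Rightarrow> bool. y (f n) \<and> n \<in> A)"
      by (cases "n \<in> A") auto
  qed
  then have "?T -` (?\<chi> ` J) \<inter> space borel \<in> sets borel"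
    using assms unfolding borel_family_def by (rule measurable_sets)
  moreover have "?T -` (?\<chi> ` J) = ?\<chi> ` {X. f -` X \<inter> A \<in> J}"
  proof (intro equalityI subsetI)
    fix y assume "y \<in> ?T -` (?\<chi> ` J)"
    then obtain X where X: "X \<in> J" "?T y = ?\<chi> X" by auto
    then have "f -` {n. y n} \<inter> A = X" by (auto simp: fun_eq_iff)
    with X(1) show "y \<in> ?\<chi> ` {X. f -` X \<inter> A \<in> J}" by (intro image_eqI[of _ _ "{n. y n}"]) auto
  next
    fix y assume "y \<in> ?\<chi> ` {X. f -` X \<inter> A \<in> J}"
    then obtain X where X: "y = ?\<chi> X" "f -` X \<inter> A \<in> J" by auto
    then show "y \<in> ?T -` (?\<chi> ` J)" by (auto intro!: image_eqI[of _ _ "f -` X \<inter> A"])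
  qed
  ultimately show ?thesis by (simp add: borel_family_def)
qed

lemma restrict_idealI:
  assumes "f -` X \<inter> A \<in> J"
  shows "f -` X \<inter> A \<in> restrict_ideal J A"
  unfolding restrict_ideal_def using assms by (intro CollectI exI[of _ "f -` X \<inter> A"]) auto

text \<open>A tall summable ideal inside the pullback of \<open>J\<close> along \<open>f\<close> would put the restriction of
  \<open>J\<close> to \<open>A\<close> Katetov-above it, as witnessed by \<open>f\<close> itself.\<close>

lemma generic_preimage_meager_if_not_katetov_above:
  assumes g0: "\<And>n. 0 \<le> g n" and "\<not> g summable_on UNIV" and lim: "g \<longlonglongrightarrow> 0"
    and J: "ideal_on UNIV J" "borel_family J"
    and A: "A \<notin> J" and f: "ideal_to_one J A f"
    and K: "\<not> (\<exists>S. tall_summable_ideal S \<and> katetov_above A (restrict_ideal J A) S)"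
  shows "meager {x. f -` generic_set g x \<inter> A \<in> J}"
proof -
  have "meager {x. generic_set g x \<in> {X. f -` X \<inter> A \<in> J}}"
  proof (rule generic_set_meager_if_borel)
    fix S assume "tall_summable_ideal S"
    with K have "\<not> katetov_above A (restrict_ideal J A) S" by blast
    then show "\<not> S \<subseteq> {X. f -` X \<inter> A \<in> J}"
      unfolding katetov_above_def by (blast intro: restrict_idealI)
  qed (use assms ideal_on_pullback borel_family_pullback in auto)
  then show ?thesis by simp
qed

lemma finite_set_of_large_values:
  fixes g :: "nat \<Rightarrow> real"
  assumes "g \<longlonglongrightarrow> 0" "0 < e"
  shows "finite {n. e \<le> g n}"
  using order_tendstoD(2)[OF assms]
  by (simp add: cofinite_eq_sequentially[symmetric] eventually_cofinite not_less)

text \<open>Points whose fibre on \<open>A\<close> is not in \<open>J\<close> exist arbitrarily far out, where \<open>g\<close> is small enough for the singleton to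
  be an admissible block; a generic real has one of these singletons among its blocks.\<close>

lemma generic_preimage_meager_if_infinitely_many_large_fibres:
  assumes lim: "g \<longlonglongrightarrow> 0" and J: "ideal_on UNIV J"
    and inf: "infinite {n. f -` {n} \<inter> A \<notin> J}"
  shows "meager {x. f -` generic_set g x \<inter> A \<in> J}"
proof -
  have "\<exists>n. f -` {n} \<inter> A \<notin> J \<and> g n \<le> 1 / 2 ^ i" for i :: nat
  proof -
    have "infinite ({n. f -` {n} \<inter> A \<notin> J} - {n. 1 / 2 ^ i \<le> g n})"
      using inf finite_set_of_large_values[OF lim, of "1 / 2 ^ i"] by (simp add: Diff_infinite_finite)
    then obtain n where "n \<in> {n. f -` {n} \<inter> A \<notin> J} - {n. 1 / 2 ^ i \<le> g n}"
      using infinite_imp_nonempty by blast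
    then show ?thesis by (intro exI[of _ n]) auto
  qed
  then obtain p where p: "\<And>i. f -` {p i} \<inter> A \<notin> J" "\<And>i::nat. g (p i) \<le> 1 / 2 ^ i" by metis
  have "f -` generic_set g x \<inter> A \<notin> J" if "digit i x = set_encode {p i}" for i x
  proof
    assume "f -` generic_set g x \<inter> A \<in> J"
    moreover have "block g i x = {p i}" using that p(2) by (intro block_eqI) auto
    then have "p i \<in> generic_set g x" unfolding generic_set_def by auto
    then have "f -` {p i} \<inter> A \<subseteq> f -` generic_set g x \<inter> A" by auto
    ultimately have "f -` {p i} \<inter> A \<in> J" by (rule ideal_on_subset[OF J])
    with p(1) show False by simp
  qed
  then have "{x. f -` generic_set g x \<inter> A \<in> J} \<subseteq> {x. \<forall>i. digit i x \<noteq> set_encode {p i}}" by blast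
  then show ?thesis
    by (rule meager_subset[OF nowhere_dense_imp_meager[OF nowhere_dense_avoiding_digits]])
qed

text \<open>A generic set contains all answers of Player I in some run that follows the winning strategy.
  Positions are finite sequences of finite sets, hence countable in number. At a position with
  allowance \<open>k\<close>, Player II may forbid the finitely many points of mass at least
  \<open>1 / 2 ^ i / (k + 1)\<close>; the answer then has mass at most \<open>1 / 2 ^ i\<close> and is admissible as the
  block at place \<open>i\<close>. For a generic real, at every position there is a place \<open>i\<close> whose
  block is exactly this answer, so Player II can steer the run through blocks.\<close>

lemma generic_preimage_meager_if_winning_strategy:
  assumes g0: "\<And>n. 0 \<le> g n" and lim: "g \<longlonglongrightarrow> 0" and J: "ideal_on UNIV J"
    and win: "I_has_winning_strategy J A f"
  shows "meager {x. f -` generic_set g x \<inter> A \<in> J}"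
proof -
  obtain k0 \<sigma> where \<sigma>: "\<And>G. legal_II G \<Longrightarrow>
      legal_I (strat_k k0 \<sigma> G) G (strat_F \<sigma> G) \<and> payoff_I J A f (strat_F \<sigma> G)"
    using win unfolding I_has_winning_strategy_def by blast
  define kp where "kp p = (if p = [] then k0 else snd (\<sigma> p))" for p
  have kp: "strat_k k0 \<sigma> G n = kp (map G [0..<n])" for G n
    by (cases n) (simp_all add: kp_def)
  have response: "finite (fst (\<sigma> (p @ [H]))) \<and> fst (\<sigma> (p @ [H])) \<inter> H = {} \<and>
      card (fst (\<sigma> (p @ [H]))) \<le> kp p" if "p \<in> lists {F. finite F}" "finite H" for p H
  proof -
    \<comment> \<open>Legality is a property of whole runs, so the position is continued arbitrarily.\<close>
    define G where "G n = (if n < length p then p ! n else H)" for n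
    have "legal_II G" using that by (auto simp: legal_II_def G_def in_lists_conv_set)
    then have "legal_I (strat_k k0 \<sigma> G) G (strat_F \<sigma> G)" using \<sigma> by blast
    moreover have "map G [0..<length p] = p" by (rule nth_equalityI) (auto simp: G_def)
    moreover have "G (length p) = H" by (simp add: G_def)
    ultimately show ?thesis
      unfolding legal_I_def kp strat_F_def by (auto dest!: spec[of _ "length p"])
  qed
  define H where "H i p = {n. 1 / 2 ^ i / (real (kp p) + 1) \<le> g n}" for i :: nat and p
  have H: "finite (H i p)" for i p
    unfolding H_def by (intro finite_set_of_large_values lim) auto
  have small: "sum g (fst (\<sigma> (p @ [H i p]))) \<le> 1 / 2 ^ i" if "p \<in> lists {F. finite F}" for i p
  proof -
    let ?F = "fst (\<sigma> (p @ [H i p]))"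
    note r = response[OF that H, of i p]
    have "sum g ?F \<le> real (card ?F) * (1 / 2 ^ i / (real (kp p) + 1))"
    proof (rule sum_bounded_above)
      fix n assume "n \<in> ?F"
      then have "n \<notin> H i p" using r by blast
      then show "g n \<le> 1 / 2 ^ i / (real (kp p) + 1)" by (simp add: H_def)
    qed
    also have "\<dots> \<le> (real (kp p) + 1) * (1 / 2 ^ i / (real (kp p) + 1))"
      using r by (intro mult_right_mono) auto
    also have "\<dots> = 1 / 2 ^ i" by simp
    finally show ?thesis .
  qed
  \<comment> \<open>The reals that miss Player I's answer at the position \<open>p\<close> at every place.\<close>
  define bad where "bad p = {x. \<forall>i. digit i x \<noteq> set_encode (fst (\<sigma> (p @ [H i p])))}" for p
  have "meager (\<Union>p\<in>lists {F. finite F}. bad p)"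
    unfolding bad_def
    by (intro meager_UN_countable countable_lists countable_Collect_finite nowhere_dense_imp_meager
        nowhere_dense_avoiding_digits)
  moreover have "{x. f -` generic_set g x \<inter> A \<in> J} \<subseteq> (\<Union>p\<in>lists {F. finite F}. bad p)"
  proof (rule ccontr)
    assume "\<not> ?thesis"
    then obtain x where x: "f -` generic_set g x \<inter> A \<in> J" "\<And>p. p \<in> lists {F. finite F} \<Longrightarrow> x \<notin> bad p"
      by blast
    have "\<forall>p. \<exists>i. p \<in> lists {F. finite F} \<longrightarrow> digit i x = set_encode (fst (\<sigma> (p @ [H i p])))"
      using x(2) unfolding bad_def by blast
    from choice[OF this] obtain \<iota> where \<iota>: "\<And>p. p \<in> lists {F. finite F} \<Longrightarrow>
        digit (\<iota> p) x = set_encode (fst (\<sigma> (p @ [H (\<iota> p) p])))" by blast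
    define P where "P = rec_nat [] (\<lambda>_ p. p @ [H (\<iota> p) p])"
    define G where "G n = H (\<iota> (P n)) (P n)" for n
    have P: "P n \<in> lists {F. finite F} \<and> map G [0..<n] = P n" for n
      by (induction n) (simp_all add: P_def G_def H)
    have "strat_F \<sigma> G n \<subseteq> generic_set g x" for n
    proof -
      have "strat_F \<sigma> G n = fst (\<sigma> (P n @ [H (\<iota> (P n)) (P n)]))"
        using P[of n] by (simp add: strat_F_def G_def)
      also have "\<dots> = block g (\<iota> (P n)) x"
        using P[of n] \<iota> small response H by (intro block_eqI[symmetric]) auto
      finally show ?thesis unfolding generic_set_def by blast
    qed
    then have "f -` (\<Union>n. strat_F \<sigma> G n) \<inter> A \<subseteq> f -` generic_set g x \<inter> A" by blast
    then have "f -` (\<Union>n. strat_F \<sigma> G n) \<inter> A \<in> restrict_ideal J A"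
      using x(1) ideal_on_subset[OF J] by (blast intro: restrict_idealI)
    moreover have "legal_II G" by (simp add: legal_II_def G_def H)
    ultimately show False using \<sigma> unfolding payoff_I_def by blast
  qed
  ultimately show ?thesis by (rule meager_subset)
qed

section \<open>Extending families with the finite intersection property\<close>

lemma has_FIP_insert:
  assumes "ideal_on UNIV J" and "\<And>F. F \<in> Fpow \<A> \<Longrightarrow> D \<inter> \<Inter>F \<notin> J"
  shows "has_FIP J (\<A> \<union> {D})"
  unfolding has_FIP_def positive_sets_def
proof (intro conjI allI impI ComplI)
  fix F assume F: "finite F \<and> F \<subseteq> \<A> \<union> {D}" and "\<Inter>F \<in> J"
  then have "F - {D} \<in> Fpow \<A>" by (auto simp: Fpow_def)
  moreover have "D \<inter> \<Inter>(F - {D}) \<subseteq> \<Inter>F" by auto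
  then have "D \<inter> \<Inter>(F - {D}) \<in> J" by (rule ideal_on_subset[OF assms(1) \<open>\<Inter>F \<in> J\<close>])
  ultimately show False using assms(2) by blast
qed simp

text \<open>If no member of \<open>I\<close> extends the family, then in particular no generic set does: each real \<open>x\<close> is
  ruled out by some finite intersection \<open>A\<close>, namely one with \<open>f -` generic_set g x \<inter> A \<in> J\<close>. It remains
  to see that each \<open>A\<close> rules out only meagerly many reals. This holds if all fibres of \<open>f\<close> on \<open>A\<close> are
  small, that is, in \<open>J\<close> (by assumption), and also if infinitely many are large. The remaining case is avoided by
  shrinking: no single fibre can be large on all finite intersections, as its singleton would
  extend the family, so once an intersection has only finitely many large fibres, a
  further finite intersection has none. One can intersect everything with the latter.\<close>

lemma meager_cover_of_maximal_FIP_family: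
  fixes g :: "nat \<Rightarrow> real"
  assumes I: "ideal_on UNIV I" and J: "ideal_on UNIV J"
    and g0: "\<And>n. 0 \<le> g n" and lim: "g \<longlonglongrightarrow> 0" and gI: "summable_ideal g \<subseteq> I"
    and generic: "\<And>A. A \<notin> J \<Longrightarrow> ideal_to_one J A f \<Longrightarrow>
      meager {x. f -` generic_set g x \<inter> A \<in> J}"
    and fip: "has_FIP J \<A>" and maximal: "\<And>B. B \<in> I \<Longrightarrow> \<not> has_FIP J (\<A> \<union> {f -` B})"
  shows "\<exists>M. (\<forall>F\<in>Fpow \<A>. meager (M F)) \<and> (\<Union>F\<in>Fpow \<A>. M F) = (UNIV :: real set)"
proof -
  have pos: "\<Inter>F \<notin> J" if "F \<in> Fpow \<A>" for F
    using fip that by (auto simp: has_FIP_def positive_sets_def Fpow_def)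
  define C where "C A = {n. f -` {n} \<inter> A \<notin> J}" for A
  have C_mono: "C A \<subseteq> C B" if "A \<subseteq> B" for A B
  proof -
    have "f -` {n} \<inter> A \<in> J" if "f -` {n} \<inter> B \<in> J" for n
      using that \<open>A \<subseteq> B\<close> by (elim ideal_on_subset[OF J]) auto
    then show ?thesis by (auto simp: C_def)
  qed
  have "\<exists>F\<in>Fpow \<A>. n \<notin> C (\<Inter>F)" for n
  proof (rule ccontr)
    assume "\<not> ?thesis"
    then have "has_FIP J (\<A> \<union> {f -` {n}})"
      by (intro has_FIP_insert[OF J]) (auto simp: C_def)
    then show False using maximal[of "{n}"] ideal_on_finite[OF I] by simp
  qed
  then obtain \<phi> where \<phi>: "\<And>n. \<phi> n \<in> Fpow \<A>" "\<And>n. n \<notin> C (\<Inter>(\<phi> n))" by metis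
  have "\<exists>F1\<in>Fpow \<A>. \<forall>F\<in>Fpow \<A>. meager {x. f -` generic_set g x \<inter> \<Inter>(F \<union> F1) \<in> J}"
  proof (cases "\<exists>F0\<in>Fpow \<A>. finite (C (\<Inter>F0))")
    case True
    then obtain F0 where F0: "F0 \<in> Fpow \<A>" "finite (C (\<Inter>F0))" by blast
    define F1 where "F1 = F0 \<union> (\<Union>n\<in>C (\<Inter>F0). \<phi> n)"
    have F1: "F1 \<in> Fpow \<A>"
      using F0 \<phi>(1) unfolding F1_def Fpow_def by auto
    have "meager {x. f -` generic_set g x \<inter> \<Inter>(F \<union> F1) \<in> J}" if "F \<in> Fpow \<A>" for F
    proof (rule generic)
      show "\<Inter>(F \<union> F1) \<notin> J" using that F1 by (intro pos) (auto simp: Fpow_def)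
      have "n \<notin> C (\<Inter>(F \<union> F1))" for n
      proof
        assume n: "n \<in> C (\<Inter>(F \<union> F1))"
        then have "n \<in> C (\<Inter>F0)" using C_mono[of "\<Inter>(F \<union> F1)" "\<Inter>F0"] by (auto simp: F1_def)
        then have "\<Inter>(F \<union> F1) \<subseteq> \<Inter>(\<phi> n)" by (auto simp: F1_def)
        with n have "n \<in> C (\<Inter>(\<phi> n))" using C_mono by blast
        with \<phi>(2) show False by blast
      qed
      then show "ideal_to_one J (\<Inter>(F \<union> F1)) f" by (simp add: ideal_to_one_def C_def)
    qed
    with F1 show ?thesis by blast
  next
    case False
    then have "\<forall>F\<in>Fpow \<A>. meager {x. f -` generic_set g x \<inter> \<Inter>(F \<union> {}) \<in> J}"
      unfolding C_def
      by (intro ballI generic_preimage_meager_if_infinitely_many_large_fibres lim J) auto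
    then show ?thesis by (intro bexI[of _ "{}"]) (auto simp: Fpow_def)
  qed
  then obtain F1 where F1: "F1 \<in> Fpow \<A>"
    "\<And>F. F \<in> Fpow \<A> \<Longrightarrow> meager {x. f -` generic_set g x \<inter> \<Inter>(F \<union> F1) \<in> J}" by blast
  have "\<exists>F\<in>Fpow \<A>. f -` generic_set g x \<inter> \<Inter>(F \<union> F1) \<in> J" for x
  proof (rule ccontr)
    assume none: "\<not> ?thesis"
    have "has_FIP J (\<A> \<union> {f -` generic_set g x})"
    proof (rule has_FIP_insert[OF J], rule notI)
      fix F assume F: "F \<in> Fpow \<A>" "f -` generic_set g x \<inter> \<Inter>F \<in> J"
      have "f -` generic_set g x \<inter> \<Inter>(F \<union> F1) \<in> J" by (rule ideal_on_subset[OF J F(2)]) auto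
      with none F(1) show False by blast
    qed
    moreover have "generic_set g x \<in> I" using generic_set_in_summable_ideal[of g, OF g0] gI by blast
    ultimately show False using maximal by blast
  qed
  with F1(2) show ?thesis
    by (intro exI[of _ "\<lambda>F. {x. f -` generic_set g x \<inter> \<Inter>(F \<union> F1) \<in> J}"]) blast
qed

section \<open>Cardinalities\<close>

lemma card_of_Fpow_le:
  assumes "infinite A"
  shows "|Fpow A| \<le>o |A|"
proof -
  have "|{F \<in> Fpow A. card F = n}| \<le>o |A|" for n
  proof (induction n)
    case 0
    have "{F \<in> Fpow A. card F = 0} = {{}}" by (auto simp: Fpow_def)
    then show ?case using assms card_of_singl_ordLeq[of A] by (metis finite.emptyI)
  next
    case (Suc n)
    have "{F \<in> Fpow A. card F = Suc n} \<subseteq>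
        (\<lambda>(a, F). insert a F) ` (A \<times> {F \<in> Fpow A. card F = n})"
    proof
      fix F assume "F \<in> {F \<in> Fpow A. card F = Suc n}"
      then obtain a F' where "F = insert a F'" "a \<notin> F'" "card F' = n" "finite F'" "F \<subseteq> A"
        by (auto simp: Fpow_def card_Suc_eq_finite)
      then show "F \<in> (\<lambda>(a, F). insert a F) ` (A \<times> {F \<in> Fpow A. card F = n})"
        by (intro image_eqI[of _ _ "(a, F')"]) (auto simp: Fpow_def)
    qed
    then have "|{F \<in> Fpow A. card F = Suc n}| \<le>o |A \<times> {F \<in> Fpow A. card F = n}|"
      using card_of_mono1 card_of_image ordLeq_transitive by blast
    also have "|A \<times> {F \<in> Fpow A. card F = n}| \<le>o |A|"
      using assms Suc
      by (intro card_of_Times_ordLeq_infinite_Field)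
        (auto simp: Field_card_of intro: card_of_mono1 card_of_card_order_on)
    finally show ?case .
  qed
  then have "|\<Union>n\<in>(UNIV :: nat set). {F \<in> Fpow A. card F = n}| \<le>o |A|"
    using assms infinite_iff_card_of_nat by (intro card_of_UNION_ordLeq_infinite) auto
  moreover have "Fpow A = (\<Union>n. {F \<in> Fpow A. card F = n})" by auto
  ultimately show ?thesis by simp
qed

lemma cov_M_le_cover:
  assumes "\<And>M. M \<in> \<M> \<Longrightarrow> meager M" "\<Union>\<M> = (UNIV :: real set)"
  shows "cov_M \<le>o |\<M>|"
  unfolding cov_M_def by (rule min_card(2)) (use assms card_of_Card_order in auto)

lemma cov_M_le_index_set:
  assumes meager: "\<And>F. F \<in> Fpow \<A> \<Longrightarrow> meager (M F)" and cover: "(\<Union>F\<in>Fpow \<A>. M F) = (UNIV :: real set)"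
  shows "cov_M \<le>o |\<A>|"
proof -
  have "infinite \<A>"
  proof
    assume "finite \<A>"
    then have "meager (\<Union>F\<in>Fpow \<A>. M F)"
      by (intro meager_UN_countable meager countable_Fpow countable_finite)
    then show False using not_meager_UNIV cover by simp
  qed
  have "cov_M \<le>o |M ` Fpow \<A>|" using meager cover by (intro cov_M_le_cover) auto
  also have "|M ` Fpow \<A>| \<le>o |Fpow \<A>|" by (rule card_of_image)
  also have "|Fpow \<A>| \<le>o |\<A>|" by (rule card_of_Fpow_le[OF \<open>infinite \<A>\<close>])
  finally show ?thesis .
qed

lemma cov_M_le_continuum: "cov_M \<le>o |UNIV :: nat set set|"
proof -
  have "meager {x :: real}" for x
    by (intro nowhere_dense_imp_meager) (simp add: nowhere_dense_def)
  then have "cov_M \<le>o |range (\<lambda>x :: real. {x})|" by (intro cov_M_le_cover) auto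
  also have "|range (\<lambda>x :: real. {x})| \<le>o |UNIV :: real set|" by (rule card_of_image)
  also have "|UNIV :: real set| \<le>o |UNIV :: nat set set|"
    using nat_sets_eqpoll_reals unfolding eqpoll_def bij_betw_def
    by (metis card_of_ordLeq inv_into_injective subset_UNIV inj_on_inv_into surj_imp_inj_inv)
  finally show ?thesis .
qed

text \<open>Both hypotheses on \<open>J\<close> enter only through the meagerness of the sets of reals whose generic set has
  small preimage. A witness family for the invariant then yields a meager cover of the line
  indexed by its finite subfamilies.\<close>

theorem theorem5p7:
  fixes I J :: "nat set set"
  assumes "ideal_on UNIV I" and "ideal_on UNIV J"
    and "\<exists>S. tall_summable_ideal S \<and> S \<subseteq> I"
    and "(\<forall>A f. A \<notin> J \<and> ideal_to_one J A f \<longrightarrow> I_has_winning_strategy J A f) \<or>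
         (borel_family J \<and>
          (\<forall>A. A \<notin> J \<longrightarrow>
             \<not> (\<exists>S. tall_summable_ideal S \<and> katetov_above A (restrict_ideal J A) S)))"
  shows "cov_M \<le>o fip I J UNIV"
proof -
  obtain g where g0: "\<And>n. 0 \<le> g n" and div: "\<not> g summable_on UNIV"
    and tall: "tall (summable_ideal g)" and gI: "summable_ideal g \<subseteq> I"
    using assms(3) unfolding tall_summable_ideal_def is_summable_ideal_def by blast
  note lim = tall_imp_tendsto_zero[OF g0 tall]
  have generic: "meager {x. f -` generic_set g x \<inter> A \<in> J}"
    if "A \<notin> J" "ideal_to_one J A f" for A f
    using assms(4)
  proof
    assume "\<forall>A f. A \<notin> J \<and> ideal_to_one J A f \<longrightarrow> I_has_winning_strategy J A f"
    with that have "I_has_winning_strategy J A f" by blast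
    then show ?thesis
      by (rule generic_preimage_meager_if_winning_strategy[OF g0 lim assms(2)])
  next
    assume "borel_family J \<and> (\<forall>A. A \<notin> J \<longrightarrow>
      \<not> (\<exists>S. tall_summable_ideal S \<and> katetov_above A (restrict_ideal J A) S))"
    with that show ?thesis
      by (intro generic_preimage_meager_if_not_katetov_above[OF g0 div lim assms(2)]) blast+
  qed
  let ?R = "{|(\<lambda>X. {X}) ` \<A>| | \<A>. has_FIP J \<A> \<and>
    \<not> (\<forall>f \<in> UNIV. \<exists>B \<in> I. has_FIP J (\<A> \<union> {f -` B}))}"
  have "fip I J UNIV \<in> insert (cardSuc |UNIV :: nat set set| ) ?R"
    unfolding fip_def by (rule min_card(1)) (auto simp: cardSuc_Card_order card_of_Card_order)
  then show ?thesis
  proof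
    assume "fip I J UNIV = cardSuc |UNIV :: nat set set|"
    moreover have "|UNIV :: nat set set| \<le>o cardSuc |UNIV :: nat set set|"
      by (intro ordLess_imp_ordLeq cardSuc_greater card_of_Card_order)
    ultimately show ?thesis using cov_M_le_continuum ordLeq_transitive by metis
  next
    assume "fip I J UNIV \<in> ?R"
    then obtain \<A> f where \<A>: "fip I J UNIV = |(\<lambda>X. {X}) ` \<A>|" "has_FIP J \<A>"
      "\<And>B. B \<in> I \<Longrightarrow> \<not> has_FIP J (\<A> \<union> {f -` B})" by blast
    obtain M where "\<And>F. F \<in> Fpow \<A> \<Longrightarrow> meager (M F)" "(\<Union>F\<in>Fpow \<A>. M F) = (UNIV :: real set)"
      using meager_cover_of_maximal_FIP_family[OF assms(1,2) g0 lim gI generic \<A>(2,3)] by blast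
    then have "cov_M \<le>o |\<A>|" by (rule cov_M_le_index_set)
    also have "|\<A>| \<le>o |(\<lambda>X. {X}) ` \<A>|"
      by (rule card_of_ordLeq[THEN iffD1]) (auto intro!: exI[of _ "\<lambda>X. {X}"])
    finally show ?thesis unfolding \<A>(1) .
  qed
qed

end
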